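(* Let $U\subseteq\mathbb{R}$ be an interval of infinite length, let $\{P_\eta:\eta\in U\}$ be an exponential family of distributions on $\mathbb{R}$ with range of natural parameters $U$, and let $I\subseteq U$ be any interval of positive length. Then for every real $\rho\ge0$ and every integer $n\ge0$ there exists no $\rho$-zCDP randomized algorithm $M:\mathbb{R}^n\to\mathbb{R}$ satisfying $\mathbb{E}_{X\leftarrow P_\eta^n,M}[M(X)]=\eta$ and $\mathbb{E}_{X\leftarrow P_\eta^n,M}[M(X)^2]<\infty$ for all $\eta\in I$.
   Context: Exponential family (here with one-dimensional data and parameter): given $D\subseteq\mathbb{R}$, a carrier measure $h:D\to[0,\infty)$ and a sufficient statistic $T:D\to\mathbb{R}$, it is the collection of probability measures $P_\eta$ with density $f_\eta(x)=h(x)\exp(\eta T(x)-Z(\eta))$ on $D$, where $Z(\eta)=\ln\left(\int_Dh(x)\exp(\eta T(x))\,dx\right)$; it is defined over all $\eta\in\mathbb{R}$ with $Z(\eta)<\infty$, and the set $U$ of these values is its range of natural parameters. Concentrated DP: a randomized algorithm $M:\mathcal{X}^n\to\mathcal{Y}$ is $\rho$-zCDP if for all $x,x'\in\mathcal{X}^n$ differing in exactly one coordinate and all $t>0$, $\mathrm{D}_{t+1}(M(x)\|M(x'))\le(t+1)\rho$, where $\mathrm{D}_{t+1}(P\|Q)=\frac1t\log\mathbb{E}_{Y\leftarrow P}\left[\left(\frac{dP}{dQ}(Y)\right)^t\right]$ is the Rényi divergence of order $t+1$ (with $\frac{dP}{dQ}$ the Radon–Nikodym derivative; $+\infty$ if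 $P\not\ll Q$). $X\leftarrow P^n$ means $n$ i.i.d. samples from $P$; $\mathbb{E}_{X,M}$ is over $X$ and the independent internal randomness of $M$. *)

theory Defs
  imports "HOL-Probability.Probability"
begin

text \<open>
  The natural logarithm on \<open>[0, \<infinity>]\<close>, with \<open>ln 0 = -\<infinity>\<close> and \<open>ln \<infinity> = \<infinity>\<close>.
\<close>

definition ln_ennreal :: "ennreal \<Rightarrow> ereal" where
  "ln_ennreal a =
     (if a = 0 then -\<infinity> else if a = \<infinity> then \<infinity> else ereal (ln (enn2real a)))"


section \<open>One-dimensional exponential families\<close>

definition log_partition :: "real set \<Rightarrow> (real \<Rightarrow> real) \<Rightarrow> (real \<Rightarrow> real) \<Rightarrow> real \<Rightarrow> ereal" where
  "log_partition D h T \<eta> =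
     ln_ennreal (\<integral>\<^sup>+x\<in>D. ennreal (h x * exp (\<eta> * T x)) \<partial>lborel)"

definition natural_parameters :: "real set \<Rightarrow> (real \<Rightarrow> real) \<Rightarrow> (real \<Rightarrow> real) \<Rightarrow> real set" where
  "natural_parameters D h T = {\<eta>. log_partition D h T \<eta> < \<infinity>}"

text \<open>
  The member with parameter \<open>\<eta>\<close>, as a measure on the Borel sets of the whole line that is
  concentrated on \<open>D\<close>. It is meaningful only for \<open>\<eta> \<in> natural_parameters D h T\<close>.
\<close>

definition exp_family_measure ::
    "real set \<Rightarrow> (real \<Rightarrow> real) \<Rightarrow> (real \<Rightarrow> real) \<Rightarrow> real \<Rightarrow> real measure" where
  "exp_family_measure D h T \<eta> =
     density lborel (\<lambda>x. ennreal (h x * exp (\<eta> * T x - real_of_ereal (log_partition D h T \<eta>)))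
                         * indicator D x)"

text \<open>
  The functions \<open>h\<close> and \<open>T\<close> matter only on \<open>D\<close>. The last conjunct merely excludes
  \<open>h = 0\<close> almost everywhere on \<open>D\<close>, where no member can be normalised
  (see \<open>prob_space_exp_family_measure\<close> below).
\<close>

definition exponential_family :: "real set \<Rightarrow> (real \<Rightarrow> real) \<Rightarrow> (real \<Rightarrow> real) \<Rightarrow> bool" where
  "exponential_family D h T \<longleftrightarrow>
     D \<in> sets borel \<and>
     h \<in> borel_measurable (restrict_space borel D) \<and>
     T \<in> borel_measurable (restrict_space borel D) \<and>
     (\<forall>x\<in>D. 0 \<le> h x) \<and>
     (\<forall>\<eta>\<in>natural_parameters D h T. prob_space (exp_family_measure D h T \<eta>))"

lemma prob_space_exp_family_measure:
  assumes D: "D \<in> sets borel"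
    and h: "h \<in> borel_measurable (restrict_space borel D)"
    and T: "T \<in> borel_measurable (restrict_space borel D)"
    and nonneg: "\<forall>x\<in>D. 0 \<le> h x"
    and \<eta>: "\<eta> \<in> natural_parameters D h T"
    and nonzero: "\<not> (AE x in lborel. x \<in> D \<longrightarrow> h x = 0)"
  shows "prob_space (exp_family_measure D h T \<eta>)"
proof -
  define z where "z = (\<integral>\<^sup>+x\<in>D. ennreal (h x * exp (\<eta> * T x)) \<partial>lborel)"
  have meas: "(\<lambda>x. ennreal (h x * exp (\<eta> * T x + c)) * indicator D x) \<in> borel_measurable lborel" for c
  proof -
    have "(\<lambda>x. ennreal (h x * exp (\<eta> * T x + c))) \<in> borel_measurable (restrict_space borel D)"
      using h T by measurable
    then show ?thesis
      using D by (subst (asm) borel_measurable_restrict_space_iff_ennreal) auto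
  qed
  have "z \<noteq> \<infinity>"
    using \<eta> by (auto simp: natural_parameters_def log_partition_def ln_ennreal_def z_def)
  moreover have "z \<noteq> 0"
  proof
    assume "z = 0"
    then have "AE x in lborel. ennreal (h x * exp (\<eta> * T x)) * indicator D x = 0"
      using meas[of 0] by (simp add: z_def nn_integral_0_iff_AE)
    then have "AE x in lborel. x \<in> D \<longrightarrow> h x = 0"
      by eventually_elim
         (use nonneg in \<open>auto simp: ennreal_eq_0_iff mult_le_0_iff indicator_def split: if_splits\<close>)
    with nonzero show False by simp
  qed
  ultimately obtain r where r: "z = ennreal r" "0 < r"
    by (cases z rule: ennreal_cases) (auto simp: less_le)
  have "log_partition D h T \<eta> = ereal (ln r)"
    using r by (auto simp: log_partition_def ln_ennreal_def z_def[symmetric])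
  then have P: "exp_family_measure D h T \<eta> =
      density lborel (\<lambda>x. ennreal (h x * exp (\<eta> * T x - ln r)) * indicator D x)"
    by (simp add: exp_family_measure_def)
  have "emeasure (exp_family_measure D h T \<eta>) UNIV =
      (\<integral>\<^sup>+x. ennreal (h x * exp (\<eta> * T x - ln r)) * indicator D x \<partial>lborel)"
    unfolding P using meas[of "- ln r"] by (simp add: emeasure_density)
  also have "\<dots> = (\<integral>\<^sup>+x. ennreal (1 / r) *
      (ennreal (h x * exp (\<eta> * T x)) * indicator D x) \<partial>lborel)"
    using r nonneg
    by (intro nn_integral_cong)
       (auto simp: indicator_def exp_diff ennreal_mult[symmetric])
  also have "\<dots> = ennreal (1 / r) * z"
    unfolding z_def using meas[of 0] by (subst nn_integral_cmult) auto
  also have "\<dots> = 1"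
    using r by (simp add: ennreal_mult[symmetric])
  finally show ?thesis
    by (intro prob_spaceI) (simp add: exp_family_measure_def)
qed


section \<open>Concentrated differential privacy\<close>

text \<open>
  The Renyi divergence of order \<open>\<alpha> > 1\<close>, in nats. Note the argument order of the library:
  \<open>absolutely_continuous Q P\<close> is \<open>P \<lless> Q\<close>, and \<open>RN_deriv Q P\<close> is \<open>dP/dQ\<close>.
\<close>

definition renyi_divergence :: "real \<Rightarrow> 'a measure \<Rightarrow> 'a measure \<Rightarrow> ereal" where
  "renyi_divergence \<alpha> P Q =
     (if absolutely_continuous Q P
      then ereal (1 / (\<alpha> - 1)) *
           ln_ennreal (\<integral>\<^sup>+y. ennreal (enn2real (RN_deriv Q P y) powr (\<alpha> - 1)) \<partial>P)
      else \<infinity>)"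

text \<open>
  A randomized algorithm from \<open>n\<close>-tuples over \<open>X\<close> to \<open>Y\<close> is a Markov kernel: \<open>M x\<close> is the law of
  the output on the dataset \<open>x\<close>. Tuples are extensional functions on the index set \<open>{..<n}\<close>.
\<close>

definition randomized_algorithm ::
    "nat \<Rightarrow> 'a measure \<Rightarrow> 'b measure \<Rightarrow> ((nat \<Rightarrow> 'a) \<Rightarrow> 'b measure) \<Rightarrow> bool" where
  "randomized_algorithm n X Y M \<longleftrightarrow> M \<in> PiM {..<n} (\<lambda>_. X) \<rightarrow>\<^sub>M prob_algebra Y"

definition zCDP ::
    "real \<Rightarrow> nat \<Rightarrow> 'a measure \<Rightarrow> ((nat \<Rightarrow> 'a) \<Rightarrow> 'b measure) \<Rightarrow> bool" where
  "zCDP \<rho> n X M \<longleftrightarrow>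
     (\<forall>x\<in>space (PiM {..<n} (\<lambda>_. X)). \<forall>x'\<in>space (PiM {..<n} (\<lambda>_. X)).
        (\<exists>!i. i < n \<and> x i \<noteq> x' i) \<longrightarrow>
        (\<forall>t>0. renyi_divergence (t + 1) (M x) (M x') \<le> ereal ((t + 1) * \<rho>)))"

text \<open>
  The law of \<open>M(X)\<close> for \<open>X\<close> consisting of \<open>n\<close> independent samples from \<open>P\<close>, with the internal
  randomness of \<open>M\<close> independent of \<open>X\<close>.
\<close>

definition output_law ::
    "nat \<Rightarrow> 'a measure \<Rightarrow> ((nat \<Rightarrow> 'a) \<Rightarrow> 'b measure) \<Rightarrow> 'b measure" where
  "output_law n P M = PiM {..<n} (\<lambda>_. P) \<bind> M"

end

theory Submission
  imports Defs "HOL-Complex_Analysis.Conformal_Mappings"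
begin

text \<open>
  Let \<open>g x\<close> be the mean of the output \<open>M x\<close>. Privacy makes \<open>g\<close> bounded on all of \<open>\<real>\<^sup>n\<close>, analyticity
  carries unbiasedness from \<open>I\<close> to long open intervals inside \<open>U\<close>, and a bounded function cannot have
  expectation \<open>\<eta>\<close> for arbitrarily large \<open>\<bar>\<eta>\<bar>\<close>.

  Boundedness: since the second moment of the output is finite on average, it is finite for some
  dataset. Any other dataset is reached from there by changing one coordinate at a time. Along one
  such change, a moment of slightly lower order stays under control, because all moments of the
  likelihood ratio are bounded by the privacy guarantee
  (\<open>nn_integral_powr_le_of_renyi_divergence\<close>). The \<open>n\<close> changes can be arranged to lower the order
  from 2 to no less than 1, with constants independent of the target dataset
  (\<open>zCDP_uniform_moment_bound\<close>).

  Analyticity: relative to the member with parameter \<open>c\<close>, the law of \<open>n\<close> samples from the member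
  with parameter \<open>\<eta>\<close> has a density proportional to \<open>exp ((\<eta> - c) * S)\<close>, where \<open>S\<close> is the sum of the
  statistics of the samples (\<open>iid_exp_family_tilt\<close>). Unbiasedness at \<open>\<eta> = c + w\<close> therefore says that
  the Laplace integrals of \<open>g\<close> and of \<open>1\<close>, evaluated at \<open>w\<close>, have ratio \<open>c + w\<close>. Both are
  holomorphic on a disc around 0, so this identity spreads from any subinterval to the whole real
  diameter of the disc (\<open>unbiased_parameter_bounded\<close>). As \<open>U\<close> is an unbounded interval, the disc can
  be centred and sized so that it covers both part of \<open>I\<close> and a parameter exceeding the bound on
  \<open>g\<close> in absolute value.
\<close>


section \<open>Moments under concentrated differential privacy\<close>

text \<open>
  A form of Young's inequality without sharp constants: according to whether \<open>L\<close> exceeds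
  \<open>a powr (r - s)\<close>, one of the two summands alone dominates the left-hand side.
\<close>
lemma powr_mult_le_powr_add:
  fixes a L r s :: real
  assumes "0 \<le> a" "0 \<le> L" "0 < s" "s < r"
  shows "L * a powr s \<le> a powr r + L * L powr (s / (r - s))"
proof (cases "L \<le> a powr (r - s)")
  case True
  then have "L * a powr s \<le> a powr (r - s) * a powr s"
    by (intro mult_right_mono) auto
  also have "\<dots> = a powr r"
    by (simp add: powr_add[symmetric])
  finally show ?thesis
    using assms by (simp add: add_increasing2)
next
  case False
  have "a powr s = (a powr (r - s)) powr (s / (r - s))"
    using assms by (simp add: powr_powr)
  also have "\<dots> \<le> L powr (s / (r - s))"
    using False assms by (intro powr_mono2) auto
  finally show ?thesis
    using assms by (simp add: add_increasing mult_left_mono)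
qed

lemma renyi_divergence_le_iff:
  assumes "1 < \<alpha>" and ac: "absolutely_continuous Q P"
  shows "renyi_divergence \<alpha> P Q \<le> ereal K \<longleftrightarrow>
    (\<integral>\<^sup>+y. ennreal (enn2real (RN_deriv Q P y) powr (\<alpha> - 1)) \<partial>P) \<le> ennreal (exp ((\<alpha> - 1) * K))"
proof -
  define z where "z = (\<integral>\<^sup>+y. ennreal (enn2real (RN_deriv Q P y) powr (\<alpha> - 1)) \<partial>P)"
  have "ereal (1 / (\<alpha> - 1)) * ln_ennreal z \<le> ereal K \<longleftrightarrow> z \<le> ennreal (exp ((\<alpha> - 1) * K))"
  proof (cases z rule: ennreal_cases)
    case (real a)
    have "ln a / (\<alpha> - 1) \<le> K \<longleftrightarrow> a \<le> exp ((\<alpha> - 1) * K)" if "0 < a"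
      using that \<open>1 < \<alpha>\<close> by (simp add: pos_divide_le_eq mult.commute)
        (metis exp_le_cancel_iff exp_ln)
    with real \<open>1 < \<alpha>\<close> show ?thesis
      by (cases "a = 0") (auto simp: ln_ennreal_def)
  next
    case top
    with \<open>1 < \<alpha>\<close> show ?thesis
      by (simp add: ln_ennreal_def top_unique)
  qed
  then show ?thesis
    using ac by (simp add: renyi_divergence_def z_def)
qed

text \<open>
  Writing the left-hand side as an integral over \<open>Q\<close> with the likelihood ratio \<open>L = dP/dQ\<close> as a
  factor, Young's inequality leaves the \<open>Q\<close>-integral of \<open>L * L powr (s / (r - s))\<close>. That is the
  \<open>P\<close>-integral of \<open>L powr (s / (r - s))\<close>, which the divergence controls.
\<close>

lemma nn_integral_powr_le_of_renyi_divergence: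
  fixes f :: "'a \<Rightarrow> real"
  assumes P: "prob_space P" and Q: "prob_space Q" and sets: "sets P = sets Q"
    and f: "f \<in> borel_measurable Q" and nonneg: "\<And>y. 0 \<le> f y"
    and sr: "0 < s" "s < r"
    and div: "renyi_divergence (s / (r - s) + 1) P Q \<le> ereal K"
  shows "(\<integral>\<^sup>+y. ennreal (f y powr s) \<partial>P) \<le>
    (\<integral>\<^sup>+y. ennreal (f y powr r) \<partial>Q) + ennreal (exp (s / (r - s) * K))"
proof -
  interpret P: prob_space P by fact
  interpret Q: prob_space Q by fact
  define t where "t = s / (r - s)"
  define L where "L = (\<lambda>y. enn2real (RN_deriv Q P y))"
  have "0 < t"
    using sr by (simp add: t_def)
  have ac: "absolutely_continuous Q P"
    using div by (auto simp: renyi_divergence_def split: if_splits)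
  note [measurable] = f
  have L[measurable]: "L \<in> borel_measurable Q"
    by (simp add: L_def)
  have fin: "AE y in Q. RN_deriv Q P y = ennreal (L y)"
    using Q.RN_deriv_finite[OF P.sigma_finite_measure_axioms ac sets]
    by eventually_elim (auto simp: L_def less_top)
  have "(\<integral>\<^sup>+y. ennreal (f y powr s) \<partial>P) = (\<integral>\<^sup>+y. RN_deriv Q P y * ennreal (f y powr s) \<partial>Q)"
    by (intro Q.RN_deriv_nn_integral ac sets) measurable
  also have "\<dots> \<le> (\<integral>\<^sup>+y. ennreal (f y powr r) + RN_deriv Q P y * ennreal (L y powr t) \<partial>Q)"
  proof (intro nn_integral_mono_AE)
    show "AE y in Q. RN_deriv Q P y * ennreal (f y powr s) \<le>
        ennreal (f y powr r) + RN_deriv Q P y * ennreal (L y powr t)"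
      using fin
    proof eventually_elim
      case (elim y)
      have "L y * f y powr s \<le> f y powr r + L y * L y powr t"
        unfolding t_def using nonneg sr by (intro powr_mult_le_powr_add) (auto simp: L_def)
      then show ?case
        unfolding elim
        by (simp add: ennreal_mult[symmetric] ennreal_plus[symmetric] L_def del: ennreal_plus)
    qed
  qed
  also have "\<dots> = (\<integral>\<^sup>+y. ennreal (f y powr r) \<partial>Q) + (\<integral>\<^sup>+y. RN_deriv Q P y * ennreal (L y powr t) \<partial>Q)"
    by (intro nn_integral_add) measurable
  also have "(\<integral>\<^sup>+y. RN_deriv Q P y * ennreal (L y powr t) \<partial>Q) = (\<integral>\<^sup>+y. ennreal (L y powr t) \<partial>P)"
    by (intro Q.RN_deriv_nn_integral[symmetric] ac sets) measurable
  also have "\<dots> \<le> ennreal (exp (t * K))"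
    using div renyi_divergence_le_iff[OF _ ac, of "t + 1" K] \<open>0 < t\<close>
    by (simp add: L_def t_def)
  finally show ?thesis
    by (simp add: t_def add_left_mono)
qed

text \<open>
  The path from \<open>x\<close> to \<open>x'\<close> replaces coordinates \<open>0, 1, \<dots>, n - 1\<close> in turn. Every replacement costs
  part of the order of the moment, so the orders \<open>r k\<close> decrease from 2 and stay above 1; this
  avoids a group privacy bound for the Renyi divergence. What matters is that \<open>B\<close> does not depend
  on \<open>x'\<close>.
\<close>

lemma zCDP_uniform_moment_bound:
  fixes M :: "(nat \<Rightarrow> 'a) \<Rightarrow> 'b measure" and f :: "'b \<Rightarrow> real"
  assumes M: "randomized_algorithm n X Y M" and dp: "zCDP \<rho> n X M"
    and f: "f \<in> borel_measurable Y" and nonneg: "\<And>y. 0 \<le> f y"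
    and x: "x \<in> space (PiM {..<n} (\<lambda>_. X))"
    and fin: "(\<integral>\<^sup>+y. ennreal (f y powr 2) \<partial>M x) < \<infinity>"
  obtains B where "0 \<le> B" "\<And>x'. x' \<in> space (PiM {..<n} (\<lambda>_. X)) \<Longrightarrow>
    (\<integral>\<^sup>+y. ennreal (f y) \<partial>M x') \<le> ennreal B"
proof -
  let ?X = "space (PiM {..<n} (\<lambda>_. X))"
  define r :: "nat \<Rightarrow> real" where "r k = 1 + 1 / (k + 1)" for k
  have r: "1 < r k" "r (Suc k) < r k" for k
    by (auto simp: r_def field_simps)
  have kernel: "prob_space (M z)" "sets (M z) = sets Y" if "z \<in> ?X" for z
    using measurable_space[OF M[unfolded randomized_algorithm_def] that]
    by (auto simp: space_prob_algebra)
  have f': "f \<in> borel_measurable (M z)" if "z \<in> ?X" for z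
    using f kernel(2)[OF that] by (simp cong: measurable_cong_sets)
  have bound_mono: "(\<integral>\<^sup>+y. ennreal (f y powr a) \<partial>M z) \<le> 1 + (\<integral>\<^sup>+y. ennreal (f y powr b) \<partial>M z)"
    if "z \<in> ?X" "0 < a" "a < b" for z a b
  proof -
    interpret prob_space "M z" using kernel that by simp
    note [measurable] = f'[OF \<open>z \<in> ?X\<close>]
    have "f y powr a \<le> 1 + f y powr b" for y
    proof (cases "f y \<le> 1")
      case True
      then have "f y powr a \<le> 1"
        using nonneg \<open>0 < a\<close> powr_mono2[of a "f y" 1] by simp
      then show ?thesis by (simp add: add_increasing2)
    next
      case False
      then show ?thesis
        using \<open>a < b\<close> by (intro add_increasing powr_mono) auto
    qed
    then have "(\<integral>\<^sup>+y. ennreal (f y powr a) \<partial>M z) \<le> (\<integral>\<^sup>+y. 1 + ennreal (f y powr b) \<partial>M z)"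
      by (intro nn_integral_mono) (simp flip: ennreal_1 ennreal_plus)
    also have "\<dots> = 1 + (\<integral>\<^sup>+y. ennreal (f y powr b) \<partial>M z)"
      by (subst nn_integral_add) (auto simp: emeasure_space_1)
    finally show ?thesis .
  qed
  have path: "\<exists>B<\<infinity>. \<forall>x'\<in>?X. (\<forall>i. k \<le> i \<longrightarrow> x' i = x i) \<longrightarrow>
      (\<integral>\<^sup>+y. ennreal (f y powr r k) \<partial>M x') \<le> B" if "k \<le> n" for k
    using that
  proof (induction k)
    case 0
    then show ?case
      using fin by (intro exI[of _ "\<integral>\<^sup>+y. ennreal (f y powr 2) \<partial>M x"])
        (auto simp: r_def fun_eq_iff[symmetric])
  next
    case (Suc k)
    then obtain B where B: "B < \<infinity>" and le_B: "\<And>z. z \<in> ?X \<Longrightarrow> (\<forall>i\<ge>k. z i = x i) \<Longrightarrow>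
        (\<integral>\<^sup>+y. ennreal (f y powr r k) \<partial>M z) \<le> B"
      by auto
    define t where "t = r (Suc k) / (r k - r (Suc k))"
    define C where "C = B + (1 + ennreal (exp (t * ((t + 1) * \<rho>))))"
    have "0 < t"
      using r[of k] r[of "Suc k"] by (simp add: t_def)
    have "(\<integral>\<^sup>+y. ennreal (f y powr r (Suc k)) \<partial>M x') \<le> C"
      if x': "x' \<in> ?X" and agree: "\<forall>i\<ge>Suc k. x' i = x i" for x'
    proof -
      define z where "z = x'(k := x k)"
      have z: "z \<in> ?X"
        using x x' \<open>Suc k \<le> n\<close> by (auto simp: z_def space_PiM PiE_iff extensional_def)
      have "\<forall>i\<ge>k. z i = x i"
        using agree by (auto simp: z_def not_less_eq_eq[symmetric])
      note le_B = le_B[OF z this]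
      show ?thesis
      proof (cases "x' = z")
        \<comment> \<open>The privacy guarantee speaks only of datasets that really differ.\<close>
        case True
        have "(\<integral>\<^sup>+y. ennreal (f y powr r (Suc k)) \<partial>M x') \<le> 1 + (\<integral>\<^sup>+y. ennreal (f y powr r k) \<partial>M z)"
          using bound_mono[OF z] r[of k] r[of "Suc k"] True by auto
        also have "\<dots> \<le> 1 + B + ennreal (exp (t * ((t + 1) * \<rho>)))"
          using le_B by (intro add_increasing2 add_left_mono) auto
        finally show ?thesis
          by (simp add: C_def ac_simps)
      next
        case False
        then have "\<exists>!i. i < n \<and> x' i \<noteq> z i"
          using \<open>Suc k \<le> n\<close> by (auto simp: z_def intro!: ex1I[of _ k])
        then have div: "renyi_divergence (t + 1) (M x') (M z) \<le> ereal ((t + 1) * \<rho>)"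
          using dp x' z \<open>0 < t\<close> by (auto simp: zCDP_def)
        have "(\<integral>\<^sup>+y. ennreal (f y powr r (Suc k)) \<partial>M x') \<le>
            (\<integral>\<^sup>+y. ennreal (f y powr r k) \<partial>M z) + ennreal (exp (t * ((t + 1) * \<rho>)))"
          unfolding t_def using r[of k] r[of "Suc k"]
          by (intro nn_integral_powr_le_of_renyi_divergence div[unfolded t_def] nonneg f' z)
             (auto simp: kernel x' z)
        also have "\<dots> \<le> C"
          unfolding C_def by (intro add_mono le_B add_increasing) auto
        finally show ?thesis .
      qed
    qed
    moreover have "C < \<infinity>"
      using B by (auto simp: C_def less_top[symmetric])
    ultimately show ?case
      by blast
  qed
  obtain B where B: "B < \<infinity>" and le_B: "\<And>x'. x' \<in> ?X \<Longrightarrow>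
      (\<integral>\<^sup>+y. ennreal (f y powr r n) \<partial>M x') \<le> B"
  proof -
    have "x' i = x i" if "x' \<in> ?X" "n \<le> i" for x' i
      using x that by (auto simp: space_PiM PiE_iff extensional_def)
    with path[of n] show ?thesis
      using that by auto
  qed
  show ?thesis
  proof (rule that)
    fix x' assume x': "x' \<in> ?X"
    have "(\<integral>\<^sup>+y. ennreal (f y) \<partial>M x') = (\<integral>\<^sup>+y. ennreal (f y powr 1) \<partial>M x')"
      using nonneg by simp
    also have "\<dots> \<le> 1 + (\<integral>\<^sup>+y. ennreal (f y powr r n) \<partial>M x')"
      using r[of n] by (intro bound_mono x') auto
    also have "\<dots> \<le> 1 + B"
      using le_B[OF x'] by (intro add_left_mono)
    also have "\<dots> = ennreal (1 + enn2real B)"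
      using B by (simp add: ennreal_plus)
    finally show "(\<integral>\<^sup>+y. ennreal (f y) \<partial>M x') \<le> ennreal (1 + enn2real B)" .
  qed simp
qed



section \<open>Analytic continuation of unbiasedness\<close>

text \<open>
  Expanding the exponential gives a power series in \<open>w\<close> that converges on the whole disc. The
  interchange of sum and integral is justified by
  \<open>exp (cmod w * \<bar>S x\<bar>) \<le> exp (cmod w * S x) + exp (- cmod w * S x)\<close>, whose right-hand side is
  integrable because \<open>cmod w\<close> and \<open>- cmod w\<close> both lie in the real diameter of the disc.
\<close>

lemma holomorphic_on_laplace_integral:
  fixes g S :: "'a \<Rightarrow> real"
  assumes g: "g \<in> borel_measurable N" and S: "S \<in> borel_measurable N"
    and bound: "\<And>x. x \<in> space N \<Longrightarrow> \<bar>g x\<bar> \<le> B"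
    and int: "\<And>u::real. \<bar>u\<bar> < \<delta> \<Longrightarrow> integrable N (\<lambda>x. exp (u * S x))"
  shows "(\<lambda>w::complex. \<integral>x. of_real (g x) * exp (w * of_real (S x)) \<partial>N) holomorphic_on ball 0 \<delta>"
proof (rule power_series_holomorphic)
  fix w :: complex assume "w \<in> ball 0 \<delta>"
  then have w: "cmod w < \<delta>" by simp
  note [measurable] = g S
  define E where "E x = exp (cmod w * S x) + exp (- cmod w * S x)" for x
  define f where "f k x = complex_of_real (g x) * ((w * of_real (S x)) ^ k /\<^sub>R fact k)" for k x
  have E: "integrable N (\<lambda>x. B * E x)"
    unfolding E_def using w by (intro integrable_mult_right Bochner_Integration.integrable_add int) auto
  have f_meas[measurable]: "f k \<in> borel_measurable N" for k
    unfolding f_def by measurable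
  have norm_f: "cmod (f k x) = \<bar>g x\<bar> * ((cmod w * \<bar>S x\<bar>) ^ k /\<^sub>R fact k)" for k x
    by (simp add: f_def norm_mult norm_power)
  have norm_f_sums: "(\<lambda>k. cmod (f k x)) sums (\<bar>g x\<bar> * exp (cmod w * \<bar>S x\<bar>))" for x
    unfolding norm_f by (intro sums_mult exp_converges)
  have exp_le_E: "\<bar>g x\<bar> * exp (cmod w * \<bar>S x\<bar>) \<le> B * E x" if "x \<in> space N" for x
  proof (intro mult_mono bound that)
    show "exp (cmod w * \<bar>S x\<bar>) \<le> E x"
      unfolding E_def by (cases "0 \<le> S x") (auto simp: abs_if)
  qed (use bound[OF that] in auto)
  have sum_le_E: "(\<Sum>k<m. cmod (f k x)) \<le> B * E x" if "x \<in> space N" for m x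
  proof -
    have "(\<Sum>k<m. cmod (f k x)) \<le> (\<Sum>k. cmod (f k x))"
      using norm_f_sums by (intro sum_le_suminf) (auto simp: sums_iff)
    also have "\<dots> \<le> B * E x"
      using norm_f_sums[of x] exp_le_E[OF that] by (simp add: sums_iff)
    finally show ?thesis .
  qed
  have f_int: "integrable N (f k)" for k
  proof (rule Bochner_Integration.integrable_bound[OF E f_meas], intro AE_I2)
    fix x assume x: "x \<in> space N"
    have "cmod (f k x) \<le> (\<Sum>j<Suc k. cmod (f j x))"
      by (intro member_le_sum) auto
    also have "\<dots> \<le> norm (B * E x)"
      using sum_le_E[OF x, of "Suc k"] by simp
    finally show "cmod (f k x) \<le> norm (B * E x)" .
  qed
  have "(\<lambda>k. integral\<^sup>L N (f k)) sums (\<integral>x. (\<Sum>k. f k x) \<partial>N)"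
  proof (rule sums_integral[OF f_int])
    show "AE x in N. summable (\<lambda>k. cmod (f k x))"
      using norm_f_sums by (auto simp: sums_iff)
    show "summable (\<lambda>k. \<integral>x. cmod (f k x) \<partial>N)"
    proof (rule summableI_nonneg_bounded)
      fix m
      have "(\<Sum>k<m. \<integral>x. cmod (f k x) \<partial>N) = (\<integral>x. (\<Sum>k<m. cmod (f k x)) \<partial>N)"
        using f_int by (intro Bochner_Integration.integral_sum[symmetric]) auto
      also have "\<dots> \<le> (\<integral>x. B * E x \<partial>N)"
        using f_int E sum_le_E by (intro integral_mono) auto
      finally show "(\<Sum>k<m. \<integral>x. cmod (f k x) \<partial>N) \<le> (\<integral>x. B * E x \<partial>N)" .
    qed simp
  qed
  moreover have "(\<Sum>k. f k x) = of_real (g x) * exp (w * of_real (S x))" for x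
    unfolding f_def by (intro sums_unique[symmetric] sums_mult exp_converges)
  moreover have "integral\<^sup>L N (f k) =
      (\<integral>x. of_real (g x * S x ^ k / fact k) \<partial>N) * (w - 0) ^ k" for k
    unfolding integral_mult_left_zero[symmetric]
    by (intro Bochner_Integration.integral_cong)
       (auto simp: f_def power_mult_distrib scaleR_conv_of_real field_simps)
  ultimately show "(\<lambda>k. (\<integral>x. complex_of_real (g x * S x ^ k / fact k) \<partial>N) * (w - 0) ^ k) sums
      (\<integral>x. of_real (g x) * exp (w * of_real (S x)) \<partial>N)"
    by simp
qed

text \<open>
  With the base parameter \<open>c\<close> at the midpoint, a single disc has the whole interval between \<open>lo\<close> and
  \<open>hi\<close> as its real diameter, so the identity \<open>G = (c + u) * K\<close> between the unnormalised mean of \<open>g\<close>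
  and the normalising constant passes at once from the subinterval to every \<open>\<eta>\<close>. There the mean of
  \<open>g\<close> is \<open>\<eta>\<close>, hence at most \<open>B\<close> in absolute value.
\<close>

lemma unbiased_parameter_bounded:
  fixes g S :: "'a \<Rightarrow> real"
  assumes g: "g \<in> borel_measurable N" and S: "S \<in> borel_measurable N"
    and bound: "\<And>x. x \<in> space N \<Longrightarrow> \<bar>g x\<bar> \<le> B"
    and prob: "\<And>\<eta>. \<lbrakk>lo < \<eta>; \<eta> < hi\<rbrakk> \<Longrightarrow> prob_space (Q \<eta>)"
    and tilt: "\<And>\<eta>. \<lbrakk>lo < \<eta>; \<eta> < hi\<rbrakk> \<Longrightarrow>
      \<exists>\<kappa>>0. Q \<eta> = density N (\<lambda>x. ennreal (exp ((\<eta> - (lo + hi) / 2) * S x) / \<kappa>))"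
    and ord: "lo \<le> a" "a < b" "b \<le> hi"
    and unbiased: "\<And>\<eta>. \<lbrakk>a < \<eta>; \<eta> < b\<rbrakk> \<Longrightarrow> (\<integral>x. g x \<partial>Q \<eta>) = \<eta>"
    and \<eta>: "lo < \<eta>" "\<eta> < hi"
  shows "\<bar>\<eta>\<bar> \<le> B"
proof -
  note [measurable] = g S
  define c \<delta> where "c = (lo + hi) / 2" and "\<delta> = (hi - lo) / 2"
  define K where "K u = (\<integral>x. exp (u * S x) \<partial>N)" for u
  define G where "G u = (\<integral>x. g x * exp (u * S x) \<partial>N)" for u
  have range: "lo < c + u" "c + u < hi" if "\<bar>u\<bar> < \<delta>" for u
    using that by (auto simp: c_def \<delta>_def field_simps)
  have tilted: "integrable N (\<lambda>x. exp (u * S x))" "0 < K u"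
      "(\<integral>x. g x \<partial>Q (c + u)) = G u / K u" if u: "\<bar>u\<bar> < \<delta>" for u
  proof -
    obtain \<kappa> where \<kappa>: "0 < \<kappa>" and Q: "Q (c + u) = density N (\<lambda>x. ennreal (exp (u * S x) / \<kappa>))"
      using tilt[OF range[OF u]] by (auto simp: c_def)
    interpret prob_space "Q (c + u)"
      using prob[OF range[OF u]] .
    have "(\<integral>\<^sup>+x. ennreal (exp (u * S x) / \<kappa>) \<partial>N) = ennreal 1"
      using emeasure_space_1 by (simp add: Q emeasure_density cong: nn_integral_cong)
    then have 1: "integrable N (\<lambda>x. exp (u * S x) / \<kappa>)" "(\<integral>x. exp (u * S x) / \<kappa> \<partial>N) = 1"
      using \<kappa> by (subst (asm) nn_integral_eq_integrable; simp)+
    then show "integrable N (\<lambda>x. exp (u * S x))"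
      using \<kappa> integrable_mult_right[OF 1(1), of \<kappa>] by simp
    have K: "K u = \<kappa>"
      using 1(2) \<kappa> by (simp add: K_def)
    then show "0 < K u"
      using \<kappa> by simp
    show "(\<integral>x. g x \<partial>Q (c + u)) = G u / K u"
      using \<kappa> by (simp add: Q integral_density K G_def mult.commute)
  qed
  define \<Phi> :: "complex \<Rightarrow> complex" where
    "\<Phi> w = (\<integral>x. of_real (g x) * exp (w * of_real (S x)) \<partial>N) -
      (of_real c + w) * (\<integral>x. of_real 1 * exp (w * of_real (S x)) \<partial>N)" for w
  have hol: "\<Phi> holomorphic_on ball 0 \<delta>"
    unfolding \<Phi>_def
    by (intro holomorphic_intros holomorphic_on_laplace_integral[where B = B]
          holomorphic_on_laplace_integral[where B = 1] bound tilted(1)) auto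
  have real: "\<Phi> (of_real u) = of_real (G u - (c + u) * K u)" for u
  proof -
    have "complex_of_real (G u) = (\<integral>x. of_real (g x) * exp (of_real u * of_real (S x)) \<partial>N)"
      unfolding G_def integral_complex_of_real[symmetric] by (simp add: exp_of_real[symmetric])
    moreover have "complex_of_real (K u) = (\<integral>x. exp (of_real u * of_real (S x)) \<partial>N)"
      unfolding K_def integral_complex_of_real[symmetric] by (simp add: exp_of_real[symmetric])
    ultimately show ?thesis
      by (simp add: \<Phi>_def)
  qed
  have zero: "\<Phi> (of_real u) = 0" if "a < c + u" "c + u < b" for u
  proof -
    have u: "\<bar>u\<bar> < \<delta>"
      using that ord by (auto simp: c_def \<delta>_def field_simps abs_less_iff)
    with tilted[OF u] unbiased[OF that] show ?thesis
      by (simp add: real field_simps)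
  qed
  define u0 where "u0 = (a + b) / 2 - c"
  have islimpt: "complex_of_real u0 islimpt complex_of_real ` {a - c<..<b - c}"
  proof (subst islimpt_approachable, intro allI impI)
    fix e :: real assume "0 < e"
    define u where "u = u0 + min (e / 2) ((b - a) / 4)"
    have "a - c < u" "u < b - c" "u \<noteq> u0" "\<bar>u - u0\<bar> < e"
      using \<open>0 < e\<close> \<open>a < b\<close> by (auto simp: u_def u0_def min_def field_simps)
    then show "\<exists>x'\<in>complex_of_real ` {a - c<..<b - c}. x' \<noteq> of_real u0 \<and> dist x' (of_real u0) < e"
      by (intro bexI[of _ "of_real u"]) (auto simp: dist_norm simp flip: of_real_diff)
  qed
  have \<eta>_range: "\<bar>\<eta> - c\<bar> < \<delta>"
    using \<eta> by (auto simp: c_def \<delta>_def field_simps abs_less_iff)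
  have "\<Phi> (of_real (\<eta> - c)) = 0"
  proof (rule analytic_continuation[OF hol _ _ _ _ islimpt])
    show "complex_of_real ` {a - c<..<b - c} \<subseteq> ball 0 \<delta>" "complex_of_real u0 \<in> ball 0 \<delta>"
      using ord by (auto simp: u0_def c_def \<delta>_def field_simps abs_less_iff simp flip: of_real_diff)
    show "\<Phi> z = 0" if "z \<in> complex_of_real ` {a - c<..<b - c}" for z
      using that by (auto intro!: zero simp: field_simps)
    show "of_real (\<eta> - c) \<in> ball (0::complex) \<delta>"
      using \<eta>_range by (simp flip: of_real_diff)
  qed auto
  then have eq: "G (\<eta> - c) = \<eta> * K (\<eta> - c)"
    unfolding real of_real_eq_0_iff by simp
  have "\<bar>G (\<eta> - c)\<bar> \<le> (\<integral>x. \<bar>g x * exp ((\<eta> - c) * S x)\<bar> \<partial>N)"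
    unfolding G_def by (rule integral_abs_bound)
  also have "\<dots> \<le> (\<integral>x. B * exp ((\<eta> - c) * S x) \<partial>N)"
    using tilted(1)[OF \<eta>_range] bound
    by (intro integral_mono') (auto simp: abs_mult intro!: mult_right_mono mult_nonneg_nonneg intro: order.trans[OF abs_ge_zero])
  also have "\<dots> = B * K (\<eta> - c)"
    by (simp add: K_def)
  finally show ?thesis
    using tilted(2)[OF \<eta>_range] by (simp add: eq abs_mult)
qed

section \<open>Tilting of product measures\<close>

lemma PiM_density:
  assumes "finite I" "product_sigma_finite M" "product_sigma_finite (\<lambda>i. density (M i) (f i))"
    and f: "\<And>i. i \<in> I \<Longrightarrow> f i \<in> borel_measurable (M i)"
  shows "PiM I (\<lambda>i. density (M i) (f i)) = density (PiM I M) (\<lambda>x. \<Prod>i\<in>I. f i (x i))"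
proof -
  interpret M: product_sigma_finite M by fact
  interpret D: product_sigma_finite "\<lambda>i. density (M i) (f i)" by fact
  note [measurable] = f
  show ?thesis
  proof (rule D.PiM_eqI[symmetric])
    show "sets (density (PiM I M) (\<lambda>x. \<Prod>i\<in>I. f i (x i))) = sets (PiM I (\<lambda>i. density (M i) (f i)))"
      by (simp only: sets_density) (intro sets_PiM_cong, auto)
    fix A assume "\<And>i. i \<in> I \<Longrightarrow> A i \<in> sets (density (M i) (f i))"
    then have A[measurable]: "\<And>i. i \<in> I \<Longrightarrow> A i \<in> sets (M i)" by simp
    have [measurable]: "Pi\<^sub>E I A \<in> sets (PiM I M)"
      using \<open>finite I\<close> A by (intro sets_PiM_I_finite)
    have "density (PiM I M) (\<lambda>x. \<Prod>i\<in>I. f i (x i)) (Pi\<^sub>E I A) =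
        (\<integral>\<^sup>+x. (\<Prod>i\<in>I. f i (x i)) * indicator (Pi\<^sub>E I A) x \<partial>PiM I M)"
      by (intro emeasure_density) measurable
    also have "\<dots> = (\<integral>\<^sup>+x. (\<Prod>i\<in>I. f i (x i) * indicator (A i) (x i)) \<partial>PiM I M)"
    proof (intro nn_integral_cong)
      fix x assume "x \<in> space (PiM I M)"
      then have "indicator (Pi\<^sub>E I A) x = (\<Prod>i\<in>I. indicator (A i) (x i) :: ennreal)"
        using \<open>finite I\<close>
        by (auto simp: indicator_def space_PiM PiE_iff prod_zero_iff)
      then show "(\<Prod>i\<in>I. f i (x i)) * indicator (Pi\<^sub>E I A) x =
          (\<Prod>i\<in>I. f i (x i) * indicator (A i) (x i))"
        by (simp add: prod.distrib)
    qed
    also have "\<dots> = (\<Prod>i\<in>I. \<integral>\<^sup>+x. f i x * indicator (A i) x \<partial>M i)"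
      using \<open>finite I\<close> by (intro M.product_nn_integral_prod) measurable
    also have "\<dots> = (\<Prod>i\<in>I. emeasure (density (M i) (f i)) (A i))"
      by (intro prod.cong refl emeasure_density[symmetric]) auto
    finally show "density (PiM I M) (\<lambda>x. \<Prod>i\<in>I. f i (x i)) (Pi\<^sub>E I A) =
        (\<Prod>i\<in>I. emeasure (density (M i) (f i)) (A i))" .
  qed fact
qed

text \<open>
  The statistic is measurable only on \<open>D\<close>; multiplying it by the indicator of \<open>D\<close> extends it to a
  Borel function on the line without changing the density.
\<close>

lemma exp_family_measure_tilt:
  assumes fam: "exponential_family D h T"
  shows "exp_family_measure D h T \<eta> = density (exp_family_measure D h T c)
    (\<lambda>x. ennreal (exp ((\<eta> - c) * (T x * indicator D x)) /
      exp (real_of_ereal (log_partition D h T \<eta>) - real_of_ereal (log_partition D h T c))))"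
proof -
  have D[measurable]: "D \<in> sets borel"
    and h: "h \<in> borel_measurable (restrict_space borel D)"
    and T: "T \<in> borel_measurable (restrict_space borel D)"
    and nonneg: "\<And>x. x \<in> D \<Longrightarrow> 0 \<le> h x"
    using fam by (auto simp: exponential_family_def)
  have [measurable]: "(\<lambda>x. T x * indicator D x) \<in> borel_measurable borel"
    using T D by (simp add: borel_measurable_restrict_space_iff mult.commute)
  define z where "z \<eta> = real_of_ereal (log_partition D h T \<eta>)" for \<eta>
  have [measurable]: "(\<lambda>x. ennreal (h x * exp (c * T x - z c)) * indicator D x) \<in> borel_measurable borel"
  proof -
    have "(\<lambda>x. ennreal (h x * exp (c * T x - z c))) \<in> borel_measurable (restrict_space borel D)"
      using h T by measurable
    then show ?thesis
      using D by (subst (asm) borel_measurable_restrict_space_iff_ennreal) auto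
  qed
  show ?thesis
    unfolding exp_family_measure_def z_def[symmetric]
  proof (subst density_density_eq; (intro density_cong AE_I2)?)
    fix x
    have "h x * exp (\<eta> * T x - z \<eta>) =
        h x * exp (c * T x - z c) * (exp ((\<eta> - c) * T x) / exp (z \<eta> - z c))"
      by (simp add: exp_diff[symmetric] exp_add[symmetric] algebra_simps)
    then show "ennreal (h x * exp (\<eta> * T x - z \<eta>)) * indicator D x =
        ennreal (h x * exp (c * T x - z c)) * indicator D x *
          ennreal (exp ((\<eta> - c) * (T x * indicator D x)) / exp (z \<eta> - z c))"
      using nonneg[of x] by (cases "x \<in> D") (simp_all add: ennreal_mult[symmetric])
  next
    have "(\<lambda>x. ennreal (h x * exp (\<eta> * T x - z \<eta>))) \<in> borel_measurable (restrict_space borel D)"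
      using h T by measurable
    then show "(\<lambda>x. ennreal (h x * exp (\<eta> * T x - z \<eta>)) * indicator D x) \<in> borel_measurable lborel"
      using D by (subst (asm) borel_measurable_restrict_space_iff_ennreal) auto
  qed measurable
qed

lemma iid_exp_family_tilt:
  fixes n :: nat
  assumes fam: "exponential_family D h T"
    and \<eta>: "\<eta> \<in> natural_parameters D h T" and c: "c \<in> natural_parameters D h T"
  shows "\<exists>\<kappa>>0. PiM {..<n} (\<lambda>_. exp_family_measure D h T \<eta>) =
    density (PiM {..<n} (\<lambda>_. exp_family_measure D h T c))
      (\<lambda>x. ennreal (exp ((\<eta> - c) * (\<Sum>i<n. T (x i) * indicator D (x i))) / \<kappa>))"
proof -
  let ?P = "exp_family_measure D h T"
  define \<kappa> where "\<kappa> = exp (real_of_ereal (log_partition D h T \<eta>) - real_of_ereal (log_partition D h T c))"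
  define v where "v x = T x * indicator D x" for x
  define f where "f x = ennreal (exp ((\<eta> - c) * v x) / \<kappa>)" for x
  have tilt: "?P \<eta> = density (?P c) f"
    unfolding f_def v_def \<kappa>_def by (rule exp_family_measure_tilt[OF fam])
  have sigma: "product_sigma_finite (\<lambda>_::nat. ?P \<theta>)" if "\<theta> \<in> natural_parameters D h T" for \<theta>
    using fam that by (auto simp: exponential_family_def product_sigma_finite_def
        intro!: prob_space_imp_sigma_finite)
  have [measurable]: "v \<in> borel_measurable borel"
    using fam by (auto simp: v_def[abs_def] exponential_family_def borel_measurable_restrict_space_iff mult.commute)
  have "f \<in> borel_measurable (?P c)"
    unfolding f_def exp_family_measure_def by simp
  then have "PiM {..<n} (\<lambda>_. ?P \<eta>) = density (PiM {..<n} (\<lambda>_. ?P c)) (\<lambda>x. \<Prod>i<n. f (x i))"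
    unfolding tilt using sigma[OF c] sigma[OF \<eta>] by (intro PiM_density) (auto simp: tilt)
  moreover have "(\<Prod>i<n. f (x i)) = ennreal (exp ((\<eta> - c) * (\<Sum>i<n. v (x i))) / \<kappa> ^ n)" for x
    unfolding f_def
    by (subst prod_ennreal) (auto simp: \<kappa>_def prod_dividef exp_sum sum_distrib_left)
  moreover have "0 < \<kappa> ^ n"
    by (simp add: \<kappa>_def)
  ultimately show ?thesis
    unfolding v_def by (intro exI[of _ "\<kappa> ^ n"]) (simp only: simp_thms)
qed


section \<open>No private unbiased estimator\<close>

text \<open>
  For an integrable, possibly unbounded integrand the identity comes from its version for nonnegative
  functions, applied to the positive and the negative part. The inner integrals are finite only
  almost everywhere, which suffices for the outer one.
\<close>

lemma integral_bind_integrable: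
  fixes f :: "'b \<Rightarrow> real"
  assumes f: "f \<in> borel_measurable K" and M: "M \<in> N \<rightarrow>\<^sub>M subprob_algebra K"
    and int: "integrable (N \<bind> M) f"
  shows "integral\<^sup>L (N \<bind> M) f = (\<integral>x. integral\<^sup>L (M x) f \<partial>N)"
proof -
  note [measurable] = f M
  define p where "p s x = (\<integral>\<^sup>+y. ennreal (s * f y) \<partial>M x)" for s x
  have p[measurable]: "p s \<in> borel_measurable N" for s
    unfolding p_def by (rule measurable_compose[OF M nn_integral_measurable_subprob_algebra]) measurable
  have kernel: "f \<in> borel_measurable (M x)" if "x \<in> space N" for x
    using f sets_kernel[OF M that] by (simp cong: measurable_cong_sets)
  have bind: "(\<integral>\<^sup>+y. ennreal (s * f y) \<partial>(N \<bind> M)) = (\<integral>\<^sup>+x. p s x \<partial>N)" for s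
    unfolding p_def by (rule nn_integral_bind[OF _ M]) measurable
  have fin: "(\<integral>\<^sup>+x. p s x \<partial>N) \<noteq> \<infinity>" if "\<bar>s\<bar> = 1" for s
  proof -
    have "(\<integral>\<^sup>+x. p s x \<partial>N) \<le> (\<integral>\<^sup>+y. ennreal (norm (f y)) \<partial>(N \<bind> M))"
      unfolding bind[symmetric] using that
      by (intro nn_integral_mono) (auto intro!: ennreal_leI simp: abs_mult[symmetric] abs_if split: if_splits)
    also have "\<dots> < \<infinity>"
      using int by (simp add: integrable_iff_bounded)
    finally show ?thesis by simp
  qed
  have AE_fin: "AE x in N. p s x \<noteq> \<infinity>" if "\<bar>s\<bar> = 1" for s
    using nn_integral_PInf_AE[OF p fin[OF that]] .
  have q: "integrable N (\<lambda>x. enn2real (p s x))" "(\<integral>x. enn2real (p s x) \<partial>N) = enn2real (\<integral>\<^sup>+x. p s x \<partial>N)"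
    if "\<bar>s\<bar> = 1" for s
  proof -
    have eq: "(\<integral>\<^sup>+x. ennreal (enn2real (p s x)) \<partial>N) = (\<integral>\<^sup>+x. p s x \<partial>N)"
      using AE_fin[OF that] by (intro nn_integral_cong_AE) (auto simp: less_top)
    show "integrable N (\<lambda>x. enn2real (p s x))"
      using fin[OF that] by (intro integrableI_nonneg) (auto simp: eq less_top)
    show "(\<integral>x. enn2real (p s x) \<partial>N) = enn2real (\<integral>\<^sup>+x. p s x \<partial>N)"
      by (subst integral_eq_nn_integral) (auto simp: eq)
  qed
  have "integral\<^sup>L (N \<bind> M) f = enn2real (\<integral>\<^sup>+x. p 1 x \<partial>N) - enn2real (\<integral>\<^sup>+x. p (- 1) x \<partial>N)"
    using real_lebesgue_integral_def[OF int] bind[of 1] bind[of "- 1"] by simp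
  also have "\<dots> = (\<integral>x. enn2real (p 1 x) - enn2real (p (- 1) x) \<partial>N)"
    using q[of 1] q[of "- 1"] by simp
  also have "\<dots> = (\<integral>x. integral\<^sup>L (M x) f \<partial>N)"
  proof (rule integral_cong_AE)
    show "(\<lambda>x. integral\<^sup>L (M x) f) \<in> borel_measurable N"
      by (rule measurable_compose[OF M integral_measurable_subprob_algebra[OF f]])
    have "AE x in N. p 1 x \<noteq> \<infinity>" "AE x in N. p (- 1) x \<noteq> \<infinity>"
      by (intro AE_fin; simp)+
    with AE_space show "AE x in N. enn2real (p 1 x) - enn2real (p (- 1) x) = integral\<^sup>L (M x) f"
    proof eventually_elim
      case (elim x)
      then have "integrable (M x) f"
        using kernel by (simp add: real_integrable_def p_def)
      then show ?case
        by (simp add: real_lebesgue_integral_def p_def)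
    qed
  qed measurable
  finally show ?thesis .
qed

theorem theoremD5:
  fixes D U I :: "real set" and h T :: "real \<Rightarrow> real"
  assumes "exponential_family D h T"
    and "U = natural_parameters D h T"
    and "is_interval U" and "emeasure lborel U = \<infinity>"
    and "I \<subseteq> U" and "is_interval I" and "emeasure lborel I > 0"
  shows "\<forall>\<rho>::real. \<rho> \<ge> 0 \<longrightarrow> (\<forall>n::nat.
           \<not> (\<exists>M :: (nat \<Rightarrow> real) \<Rightarrow> real measure.
                randomized_algorithm n borel borel M \<and>
                zCDP \<rho> n borel M \<and>
                (\<forall>\<eta>\<in>I.
                   has_bochner_integral (output_law n (exp_family_measure D h T \<eta>) M) (\<lambda>y. y) \<eta> \<and>
                   (\<integral>\<^sup>+y. ennreal (y\<^sup>2) \<partial>output_law n (exp_family_measure D h T \<eta>) M) < \<infinity>)))"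
proof (intro allI impI notI, elim exE conjE)
  fix \<rho> :: real and n :: nat and M :: "(nat \<Rightarrow> real) \<Rightarrow> real measure"
  assume alg: "randomized_algorithm n borel borel M" and dp: "zCDP \<rho> n borel M"
    and unbiased: "\<forall>\<eta>\<in>I.
      has_bochner_integral (output_law n (exp_family_measure D h T \<eta>) M) (\<lambda>y. y) \<eta> \<and>
      (\<integral>\<^sup>+y. ennreal (y\<^sup>2) \<partial>output_law n (exp_family_measure D h T \<eta>) M) < \<infinity>"
  define N where "N \<eta> = PiM {..<n} (\<lambda>_. exp_family_measure D h T \<eta>)" for \<eta>
  have law: "output_law n (exp_family_measure D h T \<eta>) M = N \<eta> \<bind> M" for \<eta>
    by (simp add: output_law_def N_def)
  have sets_N[measurable_cong]: "sets (N \<eta>) = sets (PiM {..<n} (\<lambda>_. borel))" for \<eta>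
    unfolding N_def by (intro sets_PiM_cong) (auto simp: exp_family_measure_def)
  have space_N: "space (N \<eta>) = space (PiM {..<n} (\<lambda>_. borel))" for \<eta>
    by (intro sets_eq_imp_space_eq sets_N)
  have prob_N: "prob_space (N \<eta>)" if "\<eta> \<in> U" for \<eta>
    unfolding N_def using assms that by (intro prob_space_PiM) (auto simp: exponential_family_def)
  have kernel: "M \<in> N \<eta> \<rightarrow>\<^sub>M subprob_algebra borel" for \<eta>
    using measurable_prob_algebraD[OF alg[unfolded randomized_algorithm_def]]
    by (simp add: sets_N cong: measurable_cong_sets)

  obtain a b where ab: "a \<in> I" "b \<in> I" "a < b"
  proof -
    have "\<exists>a\<in>I. \<exists>b\<in>I. a \<noteq> b"
    proof (rule ccontr)
      assume "\<not> ?thesis"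
      then obtain x where "I \<subseteq> {x}" by blast
      then have "emeasure lborel I \<le> emeasure lborel {x}"
        by (intro emeasure_mono) auto
      with \<open>emeasure lborel I > 0\<close> show False by simp
    qed
    then show ?thesis
      using that by (metis neqE)
  qed
  have I: "\<eta> \<in> I" if "a < \<eta>" "\<eta> < b" for \<eta>
    using \<open>is_interval I\<close> ab that by (meson is_interval_1 less_imp_le)

  obtain x where x: "x \<in> space (PiM {..<n} (\<lambda>_. borel))" "(\<integral>\<^sup>+y. ennreal (\<bar>y\<bar> powr 2) \<partial>M x) < \<infinity>"
  proof -
    interpret prob_space "N a"
      using ab assms by (intro prob_N) auto
    have "(\<integral>\<^sup>+x. \<integral>\<^sup>+y. ennreal (y\<^sup>2) \<partial>M x \<partial>N a) = (\<integral>\<^sup>+y. ennreal (y\<^sup>2) \<partial>(N a \<bind> M))"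
      by (rule nn_integral_bind[OF _ kernel, symmetric]) measurable
    also have "\<dots> < \<infinity>"
      using unbiased ab by (simp add: law)
    finally have "AE x in N a. (\<integral>\<^sup>+y. ennreal (y\<^sup>2) \<partial>M x) \<noteq> \<infinity>"
      by (intro nn_integral_PInf_AE measurable_compose[OF kernel nn_integral_measurable_subprob_algebra]) auto
    with AE_space have "AE x in N a. \<exists>x\<in>space (N a). (\<integral>\<^sup>+y. ennreal (y\<^sup>2) \<partial>M x) < \<infinity>"
      by eventually_elim (auto simp: less_top)
    then show ?thesis
      using that by (auto simp: space_N)
  qed
  obtain B where "0 \<le> B" and B: "\<And>x'. x' \<in> space (PiM {..<n} (\<lambda>_. borel)) \<Longrightarrow>
      (\<integral>\<^sup>+y. ennreal \<bar>y\<bar> \<partial>M x') \<le> ennreal B"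
    using zCDP_uniform_moment_bound[OF alg dp _ _ x] by auto
  define g where "g x' = (\<integral>y. y \<partial>M x')" for x'
  have g_meas: "g \<in> borel_measurable (N \<eta>)" for \<eta>
    unfolding g_def by (rule measurable_compose[OF kernel integral_measurable_subprob_algebra]) auto
  have g_bound: "\<bar>g x'\<bar> \<le> B" if "x' \<in> space (N \<eta>)" for x' \<eta>
  proof -
    have "\<bar>g x'\<bar> \<le> (\<integral>y. \<bar>y\<bar> \<partial>M x')"
      unfolding g_def by (rule integral_abs_bound)
    also have "\<dots> \<le> B"
      using B that \<open>0 \<le> B\<close> by (intro integral_real_bounded) (auto simp: space_N)
    finally show ?thesis .
  qed
  have g_unbiased: "(\<integral>x'. g x' \<partial>N \<eta>) = \<eta>" if "\<eta> \<in> I" for \<eta>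
  proof -
    have "has_bochner_integral (N \<eta> \<bind> M) (\<lambda>y. y) \<eta>"
      using unbiased that unfolding law by blast
    then have int: "integrable (N \<eta> \<bind> M) (\<lambda>y. y)"
      and mean: "(\<integral>y. y \<partial>(N \<eta> \<bind> M)) = \<eta>"
      unfolding has_bochner_integral_iff by blast+
    have id: "(\<lambda>y::real. y) \<in> borel_measurable borel"
      by simp
    have "(\<integral>y. y \<partial>(N \<eta> \<bind> M)) = (\<integral>x'. (\<integral>y. y \<partial>M x') \<partial>N \<eta>)"
      by (rule integral_bind_integrable[OF id kernel int])
    then show ?thesis
      unfolding g_def mean by (rule sym)
  qed

  define R where "R = max B (max \<bar>a\<bar> \<bar>b\<bar>)"
  obtain u where u: "u \<in> U" "R < \<bar>u\<bar>"
  proof -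
    have "\<not> bounded U"
      using emeasure_bounded_finite[of U] \<open>emeasure lborel U = \<infinity>\<close> by auto
    then show ?thesis
      using that by (auto simp: bounded_iff not_le)
  qed
  \<comment> \<open>Writing these as minimum and maximum treats unboundedness above and below at once.\<close>
  define lo hi where "lo = min u a" and "hi = max u b"
  have lohi: "lo \<in> U" "hi \<in> U"
    using u ab \<open>I \<subseteq> U\<close> by (auto simp: lo_def hi_def min_def max_def)
  have U: "\<eta> \<in> U" if "lo < \<eta>" "\<eta> < hi" for \<eta>
    using \<open>is_interval U\<close> lohi that by (meson is_interval_1 less_imp_le)
  have ord: "lo \<le> a" "a < b" "b \<le> hi"
    using ab by (auto simp: lo_def hi_def)
  have c: "(lo + hi) / 2 \<in> U"
    using ord by (intro U) auto
  define S where "S x' = (\<Sum>i<n. T (x' i) * indicator D (x' i))" for x' :: "nat \<Rightarrow> real"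
  have S_meas: "S \<in> borel_measurable (N \<eta>)" for \<eta>
  proof -
    have [measurable]: "(\<lambda>x. T x * indicator D x) \<in> borel_measurable borel"
      using assms(1) by (auto simp: exponential_family_def borel_measurable_restrict_space_iff mult.commute)
    show ?thesis
      unfolding S_def by measurable
  qed
  \<comment> \<open>Halfway between \<open>R\<close> and \<open>\<bar>u\<bar>\<close> in absolute value, on the side of \<open>u\<close>.\<close>
  define \<eta> where "\<eta> = (u + sgn u * R) / 2"
  have \<eta>: "lo < \<eta> \<and> \<eta> < hi \<and> B < \<bar>\<eta>\<bar>"
  proof -
    have R: "B \<le> R" "a \<le> R" "b \<le> R" "- R \<le> a" "- R \<le> b"
      by (auto simp: R_def)
    show ?thesis
    proof (cases "0 \<le> u")
      case True
      then have "R < u" "\<eta> = (u + R) / 2" "hi = u"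
        using u R \<open>0 \<le> B\<close> by (auto simp: \<eta>_def hi_def)
      then show ?thesis
        using R \<open>0 \<le> B\<close> ord by auto
    next
      case False
      then have "u < - R" "\<eta> = (u - R) / 2" "lo = u"
        using u R \<open>0 \<le> B\<close> by (auto simp: \<eta>_def lo_def)
      then show ?thesis
        using R \<open>0 \<le> B\<close> ord by auto
    qed
  qed
  have "\<bar>\<eta>\<bar> \<le> B"
  proof (rule unbiased_parameter_bounded[where N = "N ((lo + hi) / 2)" and Q = N and S = S,
        OF g_meas S_meas g_bound prob_N _ ord])
    show "\<exists>\<kappa>>0. N \<eta> = density (N ((lo + hi) / 2)) (\<lambda>x. ennreal (exp ((\<eta> - (lo + hi) / 2) * S x) / \<kappa>))"
      if "lo < \<eta>" "\<eta> < hi" for \<eta>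
      unfolding N_def S_def using U[OF that] c assms by (intro iid_exp_family_tilt) auto
  qed (use \<eta> in \<open>auto intro: U I g_unbiased\<close>)
  with \<eta> show False
    by simp
qed

end
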